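(* If $u=\mathbb{P}u$, and $u$ is sufficiently smooth, then, with $u=\sum_{k\ge0}a_ke^{ikx}$ its Fourier expansion, $$\mathbb{P}\left[\frac1{4\pi}\int_0^{2\pi}\frac{|u(x)-u(y)|^2(u(x)-u(y))}{1-\cos(x-y)}\,dy\right]=\frac1{2\pi}\mathbb{P}\left[|u|^2\Lambda u-u\Lambda|u|^2\right]=\sum_{\substack{p=k+\ell-m\\ k,\ell,m,p\ge0}}e^{ipx}\left(k-|k-p|\right)a_ka_\ell\overline{a_m}.$$
   Context: $u$ is a complex function on $\mathbb{T}=\mathbb{R}/(2\pi\mathbb{Z})$. $\mathbb{P}$ is the projector on non-negative frequencies (Szegő projector): $\mathbb{P}e^{ikx}=\mathbf{1}_{[0,\infty)}(k)e^{ikx}$ for $k\in\mathbb{Z}$. $\Lambda$ is the Fourier multiplier with symbol $2\pi|k|$: $\Lambda e^{ikx}=2\pi|k|e^{ikx}$. The Fourier coefficients are $a_k=\frac1{2\pi}\int_0^{2\pi}u(x)e^{-ikx}\,dx$. *)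

theory Defs
  imports "HOL-Analysis.Analysis"
begin

text \<open>Functions on the torus \<open>\<real>/(2\<pi>\<int>)\<close> are represented by
  \<open>2\<pi>\<close>-periodic functions of type \<^typ>\<open>real \<Rightarrow> complex\<close>.\<close>

definition torus_fun :: "(real \<Rightarrow> complex) \<Rightarrow> bool" where
  "torus_fun f \<longleftrightarrow> (\<forall>x. f (x + 2 * pi) = f x)"

definition C2_fun :: "(real \<Rightarrow> complex) \<Rightarrow> bool" where
  "C2_fun f \<longleftrightarrow>
     (\<exists>f'. (\<forall>x. (f has_vector_derivative f' x) (at x)) \<and> f' C1_differentiable_on UNIV)"

definition fourier_coeff :: "(real \<Rightarrow> complex) \<Rightarrow> int \<Rightarrow> complex" where
  "fourier_coeff f k =
     1 / complex_of_real (2 * pi) * (LBINT x:{0..2 * pi}. f x * cis (- (of_int k * x)))"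

text \<open>The Fourier series is an unordered sum, so this is meaningful when the coefficients
  \<open>\<sigma> k * fourier_coeff f k\<close> are absolutely summable (and at points where the series is not
  summable the value is 0 by the convention of \<^const>\<open>infsum\<close>).\<close>

definition fourier_multiplier :: "(int \<Rightarrow> complex) \<Rightarrow> (real \<Rightarrow> complex) \<Rightarrow> real \<Rightarrow> complex" where
  "fourier_multiplier \<sigma> f x = (\<Sum>\<^sub>\<infinity>k\<in>UNIV. \<sigma> k * fourier_coeff f k * cis (of_int k * x))"

definition szego :: "(real \<Rightarrow> complex) \<Rightarrow> real \<Rightarrow> complex" where
  "szego = fourier_multiplier (\<lambda>k. indicator {0..} k)"

definition Lambda :: "(real \<Rightarrow> complex) \<Rightarrow> real \<Rightarrow> complex" where
  "Lambda = fourier_multiplier (\<lambda>k. complex_of_real (2 * pi * \<bar>of_int k\<bar>))"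

text \<open>The integrand has the form \<open>0 / 0 = 0\<close> at the points \<open>y \<in> x + 2\<pi>\<int>\<close>, which form a null set.\<close>

definition cubic_integral :: "(real \<Rightarrow> complex) \<Rightarrow> real \<Rightarrow> complex" where
  "cubic_integral u x =
     1 / complex_of_real (4 * pi) *
     (LBINT y:{0..2 * pi}.
        complex_of_real ((cmod (u x - u y))\<^sup>2) * (u x - u y) / complex_of_real (1 - cos (x - y)))"

end

theory Submission
  imports Defs
begin

text \<open>Both sides are trilinear in \<open>(u, u, cnj u)\<close>, and the proof compares their symbols. Write
  \<open>u = (\<Sum>k\<ge>0. a k * cis (k x))\<close>. A \<open>C\<^sup>2\<close> function satisfies \<open>(\<Sum>k. k * |a k|) < \<infinity>\<close>
  (\<open>C2_fun_summable_weighted\<close>), and all triple series below converge absolutely because their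
  symbols grow at most linearly in each index. They are handled as absolutely convergent
  trigonometric series with repeated frequencies (\<open>trig_expansion\<close>), on which products and
  Fourier multipliers act term by term.

  For the right side, \<open>\<Lambda>\<close> multiplies by \<open>2 * pi * |frequency|\<close>, so that
  \<open>(|u|\<^sup>2 * \<Lambda> u - u * \<Lambda> |u|\<^sup>2) / (2 * pi)\<close> has the symbol \<open>k - |l - m|\<close> at \<open>(k, l, m)\<close>, with
  output frequency \<open>p = k + l - m\<close> (\<open>nonlinear_term_expansion\<close>). Since \<open>l - m = p - k\<close>, this is
  the series of the theorem.

  For the cubic integral, put \<open>z = cis (y - x)\<close>. The numerator of a single term is a constant times
  \<open>(1 - z ^ k) * (1 - z ^ l) * (1 - cnj z ^ m)\<close>, and the denominator is \<open>|1 - z|\<^sup>2 / 2\<close>. Cancelling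
  \<open>1 - z\<close> and \<open>1 - cnj z\<close> leaves a trigonometric polynomial (\<open>cubic_kernel_eq\<close>) whose mean counts
  lattice points and equals \<open>2 * (min k m - min k (max 0 (m - l)))\<close> (\<open>mean_cubic_kernel\<close>). For
  \<open>p \<ge> 0\<close> this number is \<open>(k - |l - m|) + (l - |k - m|)\<close> (\<open>symbol_symmetrization\<close>), and the two
  summands contribute equally because \<open>a k * a l\<close> is symmetric in \<open>k\<close> and \<open>l\<close>.\<close>

section \<open>Fourier coefficients\<close>

lemma fourier_coeff_eq_integral:
  assumes "continuous_on {0..2 * pi} f"
  shows "fourier_coeff f k =
           1 / complex_of_real (2 * pi) * integral {0..2 * pi} (\<lambda>x. f x * cis (- (of_int k * x)))"
proof -
  have "continuous_on {0..2 * pi} (\<lambda>x. f x * cis (- (of_int k * x)))"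
    by (intro continuous_intros assms)
  then have "set_integrable lborel {0..2 * pi} (\<lambda>x. f x * cis (- (of_int k * x)))"
    by (rule borel_integrable_atLeastAtMost')
  then show ?thesis
    unfolding fourier_coeff_def by (simp add: set_borel_integral_eq_integral(2))
qed

lemma has_vector_derivative_cis:
  "((\<lambda>x. cis (c * x)) has_vector_derivative (\<i> * of_real c) * cis (c * x)) (at x within S)"
  unfolding has_vector_derivative_def
  by (auto intro!: derivative_eq_intros simp: scaleR_conv_of_real)

lemma integral_cis_period:
  "integral {0..2 * pi} (\<lambda>x. cis (of_int n * x)) = (if n = 0 then complex_of_real (2 * pi) else 0)"
proof (cases "n = 0")
  case True
  then show ?thesis by (simp add: scaleR_conv_of_real)
next
  case False
  define F where "F = (\<lambda>x::real. cis (of_int n * x) / (\<i> * of_int n))"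
  have "(F has_vector_derivative cis (of_int n * x)) (at x within S)" for x S
    unfolding F_def
    using has_vector_derivative_divide[OF has_vector_derivative_cis[of "of_int n" x S],
        of "\<i> * of_int n"] False by simp
  then have "((\<lambda>x. cis (of_int n * x)) has_integral F (2 * pi) - F 0) {0..2 * pi}"
    by (intro fundamental_theorem_of_calculus) auto
  moreover have "F (2 * pi) = F 0"
    unfolding F_def using cis_multiple_2pi[of "of_int n"] by (simp add: mult_ac)
  ultimately show ?thesis using False by (simp add: integral_unique)
qed

lemma fourier_coeff_cis:
  "fourier_coeff (\<lambda>x. c * cis (of_int k * x)) n = (if k = n then c else 0)"
proof -
  have "fourier_coeff (\<lambda>x. c * cis (of_int k * x)) n =
      1 / complex_of_real (2 * pi) *
        integral {0..2 * pi} (\<lambda>x. c * cis (of_int k * x) * cis (- (of_int n * x)))"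
    by (intro fourier_coeff_eq_integral continuous_intros)
  also have "(\<lambda>x. c * cis (of_int k * x) * cis (- (of_int n * x)))
      = (\<lambda>x. c * cis (of_int (k - n) * x))"
    by (simp add: mult.assoc cis_mult ring_distribs)
  also have "integral {0..2 * pi} \<dots> = c * integral {0..2 * pi} (\<lambda>x. cis (of_int (k - n) * x))"
    by (rule integral_mult_right)
  finally show ?thesis unfolding integral_cis_period by simp
qed

lemma fourier_coeff_sum:
  assumes "finite S" and cont: "\<And>j. j \<in> S \<Longrightarrow> continuous_on {0..2 * pi} (g j)"
  shows "fourier_coeff (\<lambda>x. \<Sum>j\<in>S. g j x) k = (\<Sum>j\<in>S. fourier_coeff (g j) k)"
proof -
  have "integral {0..2 * pi} (\<lambda>x. (\<Sum>j\<in>S. g j x) * cis (- (of_int k * x))) =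
      (\<Sum>j\<in>S. integral {0..2 * pi} (\<lambda>x. g j x * cis (- (of_int k * x))))"
    unfolding sum_distrib_right using \<open>finite S\<close>
    by (intro integral_sum integrable_continuous_real continuous_intros cont)
  moreover have "continuous_on {0..2 * pi} (\<lambda>x. \<Sum>j\<in>S. g j x)"
    by (intro continuous_intros cont)
  ultimately show ?thesis
    by (simp add: fourier_coeff_eq_integral cont sum_distrib_left)
qed

lemma fourier_coeff_diff:
  assumes "continuous_on {0..2 * pi} f" and "continuous_on {0..2 * pi} g"
  shows "fourier_coeff (\<lambda>x. f x - g x) k = fourier_coeff f k - fourier_coeff g k"
proof -
  have "integral {0..2 * pi} (\<lambda>x. (f x - g x) * cis (- (of_int k * x))) =
      integral {0..2 * pi} (\<lambda>x. f x * cis (- (of_int k * x))) -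
      integral {0..2 * pi} (\<lambda>x. g x * cis (- (of_int k * x)))"
    unfolding left_diff_distrib
    by (intro integral_diff integrable_continuous_real continuous_intros assms)
  moreover have "continuous_on {0..2 * pi} (\<lambda>x. f x - g x)"
    by (intro continuous_intros assms)
  ultimately show ?thesis
    by (simp add: fourier_coeff_eq_integral assms right_diff_distrib)
qed

text \<open>The uniform summable majorant makes the partial sums converge uniformly, which justifies
  exchanging the sum with the integral.\<close>

lemma fourier_coeff_has_sum:
  fixes g :: "'j \<Rightarrow> real \<Rightarrow> complex"
  assumes cont: "\<And>j. continuous_on {0..2 * pi} (g j)"
    and bound: "\<And>j y. norm (g j y) \<le> M j"
    and summable: "M summable_on UNIV"
    and sum: "\<And>y. ((\<lambda>j. g j y) has_sum f y) UNIV"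
  shows "((\<lambda>j. fourier_coeff (g j) n) has_sum fourier_coeff f n) UNIV"
proof -
  let ?F = "finite_subsets_at_top (UNIV :: 'j set)"
  let ?e = "\<lambda>y::real. cis (- (of_int n * y))"
  have lim_f: "uniform_limit {0..2 * pi} (\<lambda>X y. \<Sum>j\<in>X. g j y) f ?F"
    by (rule Weierstrass_m_test_general'[OF bound sum summable])
  have cont_f: "continuous_on {0..2 * pi} f"
    by (rule uniform_limit_theorem[OF _ lim_f])
       (auto intro!: always_eventually continuous_intros cont)
  have bound_e: "norm (g j y * ?e y) \<le> M j" for j y
    using bound by (simp add: norm_mult)
  have sum_e: "((\<lambda>j. g j y * ?e y) has_sum f y * ?e y) UNIV" for y
    by (rule has_sum_cmult_left[OF sum])
  have lim: "uniform_limit {0..2 * pi} (\<lambda>X y. \<Sum>j\<in>X. g j y * ?e y) (\<lambda>y. f y * ?e y) ?F"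
    by (rule Weierstrass_m_test_general'[OF bound_e sum_e summable])
  have cont_e: "continuous_on {0..2 * pi} (\<lambda>y. g j y * ?e y)" for j
    by (intro continuous_intros cont)
  obtain I J where I: "\<And>X. ((\<lambda>y. \<Sum>j\<in>X. g j y * ?e y) has_integral I X) {0..2 * pi}"
    and J: "((\<lambda>y. f y * ?e y) has_integral J) {0..2 * pi}"
    and IJ: "(I \<longlongrightarrow> J) ?F"
    by (rule uniform_limit_integral[OF lim]) (auto intro!: continuous_intros cont)
  have "1 / complex_of_real (2 * pi) * I X = (\<Sum>j\<in>X. fourier_coeff (g j) n)" for X
  proof -
    have "I X = integral {0..2 * pi} (\<lambda>y. \<Sum>j\<in>X. g j y * ?e y)"
      using integral_unique[OF I[of X]] by simp
    also have "\<dots> = (\<Sum>j\<in>X. integral {0..2 * pi} (\<lambda>y. g j y * ?e y))"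
    proof (cases "finite X")
      case True
      then show ?thesis
        by (intro integral_sum integrable_continuous_real cont_e)
    qed simp
    finally show ?thesis
      by (simp add: sum_distrib_left fourier_coeff_eq_integral[OF cont])
  qed
  moreover have "1 / complex_of_real (2 * pi) * J = fourier_coeff f n"
    using J by (simp add: fourier_coeff_eq_integral[OF cont_f] integral_unique)
  ultimately show ?thesis
    unfolding has_sum_def using tendsto_mult_left[OF IJ, of "1 / complex_of_real (2 * pi)"] by simp
qed

section \<open>Absolutely convergent trigonometric series\<close>

text \<open>The index type is arbitrary and \<open>n\<close> need not be injective: a product of expansions is indexed
  by pairs, and many pairs may carry the same frequency. Collecting equal frequencies is thus
  postponed until coefficients are read off.\<close>

definition trig_expansion ::
    "(real \<Rightarrow> complex) \<Rightarrow> ('j \<Rightarrow> complex) \<Rightarrow> ('j \<Rightarrow> int) \<Rightarrow> bool" where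
  "trig_expansion f c n \<longleftrightarrow>
     (\<lambda>j. norm (c j)) summable_on UNIV \<and>
     (\<forall>x. ((\<lambda>j. c j * cis (of_int (n j) * x)) has_sum f x) UNIV)"

lemma trig_expansionI:
  assumes "(\<lambda>j. norm (c j)) summable_on UNIV"
    and "\<And>x. ((\<lambda>j. c j * cis (of_int (n j) * x)) has_sum f x) UNIV"
  shows "trig_expansion f c n"
  using assms by (simp add: trig_expansion_def)

lemma
  assumes "trig_expansion f c n"
  shows trig_expansion_summable: "(\<lambda>j. norm (c j)) summable_on UNIV"
    and trig_expansion_has_sum: "((\<lambda>j. c j * cis (of_int (n j) * x)) has_sum f x) UNIV"
  using assms by (simp_all add: trig_expansion_def)

lemma trig_expansion_fourier_coeff:
  fixes n :: "'j \<Rightarrow> int"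
  assumes "trig_expansion f c n"
  shows "(c has_sum fourier_coeff f k) {j. n j = k}"
proof -
  have "((\<lambda>j. fourier_coeff (\<lambda>x. c j * cis (of_int (n j) * x)) k) has_sum fourier_coeff f k) UNIV"
    by (rule fourier_coeff_has_sum[where M = "\<lambda>j. norm (c j)"])
       (auto intro!: continuous_intros trig_expansion_has_sum[OF assms]
          trig_expansion_summable[OF assms] simp: norm_mult)
  then show ?thesis
    by (subst has_sum_cong_neutral[where T = UNIV and
          g = "\<lambda>j. fourier_coeff (\<lambda>x. c j * cis (of_int (n j) * x)) k"])
       (auto simp: fourier_coeff_cis)
qed

text \<open>A Fourier multiplier is defined through the Fourier coefficients of \<open>f\<close>; it nevertheless acts
  term by term on an expansion with repeated frequencies, since each coefficient is the sum of
  the \<open>c j\<close> of that frequency and \<open>\<sigma>\<close> is constant on such a group.\<close>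

lemma trig_expansion_multiplier:
  fixes n :: "'j \<Rightarrow> int"
  assumes f: "trig_expansion f c n"
    and summable: "(\<lambda>j. norm (\<sigma> (n j) * c j)) summable_on UNIV"
  shows "trig_expansion (fourier_multiplier \<sigma> f) (\<lambda>j. \<sigma> (n j) * c j) n"
proof (rule trig_expansionI[OF summable])
  fix x :: real
  let ?t = "\<lambda>j. \<sigma> (n j) * c j * cis (of_int (n j) * x)"
  let ?h = "\<lambda>(k, j). ?t j"
  let ?S = "Sigma (UNIV :: int set) (\<lambda>k. {j. n j = k})"
  have "(\<lambda>j. norm (?t j)) summable_on UNIV"
    using summable by (simp add: norm_mult)
  then have "?t summable_on UNIV"
    by (rule abs_summable_summable)
  then have all: "(?t has_sum infsum ?t UNIV) UNIV"
    by (rule has_sum_infsum)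
  \<comment> \<open>Grouping the indices by frequency turns the sum over indices into the defining sum over
    \<open>\<int>\<close>.\<close>
  have "(?h has_sum infsum ?t UNIV) ?S"
    by (rule iffD1[OF has_sum_reindex_bij_witness[where j = "\<lambda>j. (n j, j)" and i = snd,
              OF _ _ _ _ _ refl] all]) auto
  moreover have "((\<lambda>j. ?h (k, j)) has_sum \<sigma> k * fourier_coeff f k * cis (of_int k * x)) {j. n j = k}"
    for k
  proof -
    have "((\<lambda>j. \<sigma> k * c j * cis (of_int k * x)) has_sum
            \<sigma> k * fourier_coeff f k * cis (of_int k * x)) {j. n j = k}"
      by (intro has_sum_cmult_left has_sum_cmult_right trig_expansion_fourier_coeff f)
    then show ?thesis
      by (rule iffD1[OF has_sum_cong, rotated]) auto
  qed
  ultimately have "((\<lambda>k. \<sigma> k * fourier_coeff f k * cis (of_int k * x)) has_sum infsum ?t UNIV) UNIV"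
    by (rule has_sum_SigmaD)
  then have "fourier_multiplier \<sigma> f x = infsum ?t UNIV"
    unfolding fourier_multiplier_def by (rule infsumI)
  with all show "(?t has_sum fourier_multiplier \<sigma> f x) UNIV" by simp
qed

lemma abs_summable_times:
  fixes f g :: "_ \<Rightarrow> complex"
  assumes "(\<lambda>i. norm (f i)) summable_on UNIV" and "(\<lambda>j. norm (g j)) summable_on UNIV"
  shows "(\<lambda>p. norm (case p of (i, j) \<Rightarrow> f i * g j)) summable_on UNIV"
proof -
  have "(\<lambda>p. norm ((\<lambda>(i, j). f i * g j) p)) summable_on Sigma UNIV (\<lambda>_. UNIV)"
  proof (rule summable_on_SigmaI)
    show "((\<lambda>j. norm ((\<lambda>(i, j). f i * g j) (i, j))) has_sum
            norm (f i) * infsum (\<lambda>j. norm (g j)) UNIV) UNIV" for i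
      using has_sum_cmult_right[OF has_sum_infsum[OF assms(2)]] by (simp add: norm_mult)
    show "(\<lambda>i. norm (f i) * infsum (\<lambda>j. norm (g j)) UNIV) summable_on UNIV"
      by (rule summable_on_cmult_left[OF assms(1)])
  qed auto
  then show ?thesis by simp
qed

lemma has_sum_product:
  fixes f g :: "_ \<Rightarrow> complex"
  assumes f: "(f has_sum s) UNIV" and g: "(g has_sum t) UNIV"
    and summable: "(\<lambda>p. norm (case p of (i, j) \<Rightarrow> f i * g j)) summable_on UNIV"
  shows "((\<lambda>(i, j). f i * g j) has_sum s * t) UNIV"
proof -
  have "((\<lambda>(i, j). f i * g j) has_sum s * t) (Sigma UNIV (\<lambda>_. UNIV))"
  proof (rule has_sum_SigmaI)
    show "((\<lambda>j. (\<lambda>(i, j). f i * g j) (i, j)) has_sum f i * t) UNIV" for i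
      using has_sum_cmult_right[OF g] by simp
    show "((\<lambda>i. f i * t) has_sum s * t) UNIV"
      by (rule has_sum_cmult_left[OF f])
    show "(\<lambda>(i, j). f i * g j) summable_on Sigma UNIV (\<lambda>_. UNIV)"
      using abs_summable_summable[OF summable] by simp
  qed
  then show ?thesis by simp
qed

lemma trig_expansion_mult:
  assumes f: "trig_expansion f c n" and g: "trig_expansion g d m"
  shows "trig_expansion (\<lambda>x. f x * g x) (\<lambda>(i, j). c i * d j) (\<lambda>(i, j). n i + m j)"
proof (rule trig_expansionI)
  show summable: "(\<lambda>p. norm (case p of (i, j) \<Rightarrow> c i * d j)) summable_on UNIV"
    by (rule abs_summable_times[OF trig_expansion_summable[OF f] trig_expansion_summable[OF g]])
  fix x :: real
  have eq: "(\<lambda>(i, j). (c i * cis (of_int (n i) * x)) * (d j * cis (of_int (m j) * x))) =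
        (\<lambda>p. (\<lambda>(i, j). c i * d j) p * cis (of_int ((\<lambda>(i, j). n i + m j) p) * x))"
    by (auto simp: ring_distribs mult_ac simp flip: cis_mult)
  have "((\<lambda>(i, j). (c i * cis (of_int (n i) * x)) * (d j * cis (of_int (m j) * x))) has_sum f x * g x) UNIV"
  proof (rule has_sum_product[OF trig_expansion_has_sum[OF f] trig_expansion_has_sum[OF g]])
    show "(\<lambda>p. norm (case p of (i, j) \<Rightarrow> (c i * cis (of_int (n i) * x)) * (d j * cis (of_int (m j) * x)))) summable_on UNIV"
      using summable by (simp add: case_prod_unfold norm_mult)
  qed
  then show "((\<lambda>p. (\<lambda>(i, j). c i * d j) p * cis (of_int ((\<lambda>(i, j). n i + m j) p) * x)) has_sum f x * g x) UNIV"
    by (simp only: eq)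
qed

lemma trig_expansion_cnj:
  assumes "trig_expansion f c n"
  shows "trig_expansion (\<lambda>x. cnj (f x)) (\<lambda>j. cnj (c j)) (\<lambda>j. - n j)"
proof (rule trig_expansionI)
  show "(\<lambda>j. norm (cnj (c j))) summable_on UNIV"
    using trig_expansion_summable[OF assms] by simp
  fix x :: real
  have "((\<lambda>j. cnj (c j * cis (of_int (n j) * x))) has_sum cnj (f x)) UNIV"
    using trig_expansion_has_sum[OF assms, of x] by (subst has_sum_cnj_iff)
  then show "((\<lambda>j. cnj (c j) * cis (of_int (- n j) * x)) has_sum cnj (f x)) UNIV"
    by (simp add: cis_cnj)
qed

lemma trig_expansion_diff:
  assumes "trig_expansion f c n" and "trig_expansion g d n"
  shows "trig_expansion (\<lambda>x. f x - g x) (\<lambda>j. c j - d j) n"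
proof (rule trig_expansionI)
  have "(\<lambda>j. norm (c j) + norm (d j)) summable_on UNIV"
    by (intro summable_on_add trig_expansion_summable[OF assms(1)] trig_expansion_summable[OF assms(2)])
  then show "(\<lambda>j. norm (c j - d j)) summable_on UNIV"
    by (rule Infinite_Sum.abs_summable_on_comparison_test') (rule norm_triangle_ineq4)
  show "((\<lambda>j. (c j - d j) * cis (of_int (n j) * x)) has_sum f x - g x) UNIV" for x
    using has_sum_add[OF trig_expansion_has_sum[OF assms(1)]
        has_sum_uminusI[OF trig_expansion_has_sum[OF assms(2)]]]
    by (simp add: left_diff_distrib)
qed

lemma szego_expansion:
  assumes f: "trig_expansion f c n"
  shows "trig_expansion (szego f) (\<lambda>j. indicator {0..} (n j) * c j) n"
  unfolding szego_def
proof (rule trig_expansion_multiplier[OF f])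
  show "(\<lambda>j. norm (indicator {0..} (n j) * c j)) summable_on UNIV"
    by (rule Infinite_Sum.abs_summable_on_comparison_test'[OF trig_expansion_summable[OF f]])
       (auto simp: indicator_def)
qed

section \<open>Coefficient decay of smooth functions\<close>

lemma torus_fun_derivative:
  assumes f: "torus_fun f" and d: "\<And>x. (f has_vector_derivative f' x) (at x)"
  shows "torus_fun f'"
  unfolding torus_fun_def
proof
  fix x
  have "((\<lambda>y. f (y + 2 * pi)) has_vector_derivative f' (x + 2 * pi)) (at x)"
  proof -
    have "((\<lambda>y. y + 2 * pi) has_vector_derivative 1 + 0) (at x)"
      by (intro has_vector_derivative_add has_vector_derivative_id has_vector_derivative_const)
    then show ?thesis
      using vector_diff_chain_at[of "\<lambda>y. y + 2 * pi" 1 x f "f' (x + 2 * pi)"] d[of "x + 2 * pi"]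
      by (simp add: o_def)
  qed
  then have "(f has_vector_derivative f' (x + 2 * pi)) (at x)"
    using f by (simp add: torus_fun_def)
  then show "f' (x + 2 * pi) = f' x"
    by (rule vector_derivative_unique_at[OF _ d])
qed

text \<open>Integration by parts; periodicity cancels the boundary terms.\<close>

lemma fourier_coeff_derivative:
  assumes f: "torus_fun f" and d: "\<And>x. (f has_vector_derivative f' x) (at x)"
    and cont': "continuous_on UNIV f'"
  shows "fourier_coeff f' k = \<i> * of_int k * fourier_coeff f k"
proof -
  let ?e = "\<lambda>x::real. cis (- (of_int k * x))"
  have cont: "continuous_on UNIV f"
    by (intro continuous_at_imp_continuous_on ballI has_vector_derivative_continuous[OF d])
  have ce: "continuous_on {0..2*pi} ?e" by (intro continuous_intros)
  have c: "continuous_on {0..2*pi} f" "continuous_on {0..2*pi} f'"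
    by (auto intro: continuous_on_subset[OF cont] continuous_on_subset[OF cont'])
  have "(?e has_vector_derivative (- \<i> * of_int k) * ?e x) (at x)" for x
    using has_vector_derivative_cis[of "- of_int k" x] by simp
  then have "((\<lambda>x. f x * ?e x) has_vector_derivative
        f x * ((- \<i> * of_int k) * ?e x) + f' x * ?e x) (at x)" for x
    by (intro has_vector_derivative_mult d)
  note deriv = has_vector_derivative_at_within[OF this]
  have "((\<lambda>x. f x * ((- \<i> * of_int k) * ?e x) + f' x * ?e x) has_integral
        f (2 * pi) * ?e (2 * pi) - f 0 * ?e 0) {0..2 * pi}"
    by (intro fundamental_theorem_of_calculus deriv) auto
  moreover have "f (2 * pi) = f 0"
    using f[unfolded torus_fun_def, rule_format, of 0] by simp
  moreover have "?e (2 * pi) = ?e 0"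
    using cis_multiple_2pi[of "- of_int k"] by (simp add: mult_ac)
  ultimately have "integral {0..2 * pi} (\<lambda>x. (- \<i> * of_int k) * (f x * ?e x) + f' x * ?e x) = 0"
    by (simp add: integral_unique mult_ac)
  also have "integral {0..2 * pi} (\<lambda>x. (- \<i> * of_int k) * (f x * ?e x) + f' x * ?e x) =
      integral {0..2 * pi} (\<lambda>x. (- \<i> * of_int k) * (f x * ?e x)) +
      integral {0..2 * pi} (\<lambda>x. f' x * ?e x)"
    by (intro integral_add integrable_continuous_real continuous_intros c)
  also have "integral {0..2 * pi} (\<lambda>x. (- \<i> * of_int k) * (f x * ?e x)) =
      (- \<i> * of_int k) * integral {0..2 * pi} (\<lambda>x. f x * ?e x)"
    by (rule integral_mult_right)
  finally have "integral {0..2 * pi} (\<lambda>x. f' x * ?e x) =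
      - (- \<i> * of_int k * integral {0..2 * pi} (\<lambda>x. f x * ?e x))"
    by (rule minus_unique[symmetric])
  then show ?thesis
    by (simp add: fourier_coeff_eq_integral c)
qed

text \<open>Expand the integral of \<open>|f - P|\<^sup>2 \<ge> 0\<close>, where \<open>P\<close> is the partial Fourier sum of \<open>f\<close> over \<open>S\<close>.\<close>

lemma bessel_inequality:
  assumes cont: "continuous_on {0..2 * pi} f" and "finite S"
  shows "2 * pi * (\<Sum>k\<in>S. (norm (fourier_coeff f k))\<^sup>2) \<le> integral {0..2 * pi} (\<lambda>x. (norm (f x))\<^sup>2)"
proof -
  define c where "c = fourier_coeff f"
  define P where "P = (\<lambda>x::real. \<Sum>k\<in>S. c k * cis (of_int k * x))"
  define N where "N = complex_of_real (\<Sum>k\<in>S. (norm (c k))\<^sup>2)"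
  have cP: "continuous_on {0..2 * pi} P"
    unfolding P_def by (intro continuous_intros)
  have N: "N = (\<Sum>k\<in>S. c k * cnj (c k))"
    unfolding N_def of_real_sum by (intro sum.cong refl complex_norm_square)
  \<comment> \<open>Pairing with \<open>P\<close> only sees the coefficients in \<open>S\<close>; \<open>f\<close> and \<open>P\<close> share these, so
    \<open>f - P\<close> is orthogonal to \<open>P\<close>.\<close>
  have pair: "integral {0..2 * pi} (\<lambda>x. g x * cnj (P x)) =
      complex_of_real (2 * pi) * (\<Sum>k\<in>S. fourier_coeff g k * cnj (c k))"
    if g: "continuous_on {0..2 * pi} g" for g
  proof -
    have "(\<lambda>x. g x * cnj (P x)) = (\<lambda>x. \<Sum>k\<in>S. g x * cis (- (of_int k * x)) * cnj (c k))"
      by (simp add: P_def sum_distrib_left cis_cnj mult_ac)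
    then have "integral {0..2 * pi} (\<lambda>x. g x * cnj (P x)) =
        integral {0..2 * pi} (\<lambda>x. \<Sum>k\<in>S. g x * cis (- (of_int k * x)) * cnj (c k))"
      by (rule arg_cong)
    also have "\<dots> = (\<Sum>k\<in>S. integral {0..2 * pi} (\<lambda>x. g x * cis (- (of_int k * x)) * cnj (c k)))"
      using \<open>finite S\<close>
      by (intro integral_sum integrable_continuous_real continuous_intros g)
    also have "\<dots> = (\<Sum>k\<in>S. integral {0..2 * pi} (\<lambda>x. g x * cis (- (of_int k * x))) * cnj (c k))"
      by simp
    finally show ?thesis
      by (simp add: fourier_coeff_eq_integral[OF g] sum_distrib_left)
  qed
  have cP_coeff: "fourier_coeff P k = c k" if "k \<in> S" for k
  proof -
    have "fourier_coeff P k = (\<Sum>j\<in>S. fourier_coeff (\<lambda>x. c j * cis (of_int j * x)) k)"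
      unfolding P_def by (intro fourier_coeff_sum continuous_intros \<open>finite S\<close>)
    then show ?thesis
      using that \<open>finite S\<close> by (simp add: fourier_coeff_cis)
  qed
  have 1: "integral {0..2 * pi} (\<lambda>x. f x * cnj (P x)) = complex_of_real (2 * pi) * N"
    using pair[OF cont] by (simp add: N c_def)
  have 2: "integral {0..2 * pi} (\<lambda>x. P x * cnj (P x)) = complex_of_real (2 * pi) * N"
    using pair[OF cP] cP_coeff by (simp add: N)
  have i: "(\<lambda>x. (norm (f x))\<^sup>2) integrable_on {0..2 * pi}"
    "(\<lambda>x. 2 * Re (f x * cnj (P x))) integrable_on {0..2 * pi}"
    "(\<lambda>x. Re (P x * cnj (P x))) integrable_on {0..2 * pi}"
    by (intro integrable_continuous_real continuous_intros cont cP)+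
  have "0 \<le> integral {0..2 * pi} (\<lambda>x. (norm (f x - P x))\<^sup>2)"
    by (intro integral_nonneg integrable_continuous_real continuous_intros cont cP) auto
  also have "(\<lambda>x. (norm (f x - P x))\<^sup>2) =
      (\<lambda>x. (norm (f x))\<^sup>2 - 2 * Re (f x * cnj (P x)) + Re (P x * cnj (P x)))"
    unfolding cmod_power2 by (simp add: power2_eq_square algebra_simps)
  also have "integral {0..2 * pi} \<dots> =
      integral {0..2 * pi} (\<lambda>x. (norm (f x))\<^sup>2)
      - 2 * integral {0..2 * pi} (\<lambda>x. Re (f x * cnj (P x)))
      + integral {0..2 * pi} (\<lambda>x. Re (P x * cnj (P x)))"
    using integral_add[OF integrable_diff[OF i(1,2)] i(3)] integral_diff[OF i(1,2)]
    by (simp only: integral_mult_right)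
  also have "integral {0..2 * pi} (\<lambda>x. Re (f x * cnj (P x))) = Re (integral {0..2 * pi} (\<lambda>x. f x * cnj (P x)))"
    by (rule integral_linear[OF _ bounded_linear_Re, unfolded o_def])
       (intro integrable_continuous_real continuous_intros cont cP)
  also have "integral {0..2 * pi} (\<lambda>x. Re (P x * cnj (P x))) = Re (integral {0..2 * pi} (\<lambda>x. P x * cnj (P x)))"
    by (rule integral_linear[OF _ bounded_linear_Re, unfolded o_def])
       (intro integrable_continuous_real continuous_intros cont cP)
  finally show ?thesis
    by (simp add: 1 2 N_def c_def)
qed

text \<open>This is what the smoothness of \<open>u\<close> is used for. A bound \<open>O(1 / k\<^sup>2)\<close> on the coefficients would
  only give a logarithmically divergent majorant; Bessel's inequality for the second derivative
  gives \<open>k\<^sup>2 * |a k|\<close> in \<open>\<ell>\<^sup>2\<close>, and multiplying by \<open>1 / k\<close> in \<open>\<ell>\<^sup>2\<close> gives the claim.\<close>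

lemma C2_fun_summable_weighted:
  assumes "torus_fun u" and "C2_fun u"
  shows "(\<lambda>k. real k * norm (fourier_coeff u (int k))) summable_on UNIV"
proof -
  obtain u' u'' where d: "\<And>x. (u has_vector_derivative u' x) (at x)"
    and d': "\<And>x. (u' has_vector_derivative u'' x) (at x)" and cont'': "continuous_on UNIV u''"
    using assms(2) unfolding C2_fun_def C1_differentiable_on_def by blast
  have cont': "continuous_on UNIV u'"
    by (intro continuous_at_imp_continuous_on ballI has_vector_derivative_continuous[OF d'])
  have per': "torus_fun u'" using torus_fun_derivative[OF assms(1) d] .
  define b where "b = (\<lambda>k::nat. norm (fourier_coeff u'' (int k)))"
  have b: "b k = (real k)\<^sup>2 * norm (fourier_coeff u (int k))" for k
    unfolding b_def fourier_coeff_derivative[OF per' d' cont'']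
      fourier_coeff_derivative[OF assms(1) d cont']
    by (simp add: norm_mult power2_eq_square)
  have c'': "continuous_on {0..2 * pi} u''"
    by (auto intro: continuous_on_subset[OF cont''])
  have "(\<lambda>k. (b k)\<^sup>2) summable_on UNIV"
  proof (rule nonneg_bdd_above_summable_on)
    show "bdd_above (sum (\<lambda>k. (b k)\<^sup>2) ` {F. F \<subseteq> UNIV \<and> finite F})"
    proof (rule bdd_aboveI2)
      fix F :: "nat set" assume "F \<in> {F. F \<subseteq> UNIV \<and> finite F}"
      then have "2 * pi * (\<Sum>k\<in>int ` F. (norm (fourier_coeff u'' k))\<^sup>2) \<le>
          integral {0..2 * pi} (\<lambda>x. (norm (u'' x))\<^sup>2)"
        by (intro bessel_inequality c'') auto
      then show "(\<Sum>k\<in>F. (b k)\<^sup>2) \<le> integral {0..2 * pi} (\<lambda>x. (norm (u'' x))\<^sup>2) / (2 * pi)"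
        by (simp add: b_def sum.reindex field_simps)
    qed
  qed simp
  moreover have "(\<lambda>k. 1 / (real k)\<^sup>2) summable_on UNIV"
    using inverse_power_summable[of 2, where 'a = real]
    by (subst summable_on_UNIV_nonneg_real_iff) (auto simp: inverse_eq_divide power_divide)
  ultimately have sum: "(\<lambda>k. (b k)\<^sup>2 + 1 / (real k)\<^sup>2) summable_on UNIV"
    by (rule summable_on_add)
  show ?thesis
  proof (rule summable_on_comparison_test[OF sum])
    fix k :: nat
    show "real k * norm (fourier_coeff u (int k)) \<le> (b k)\<^sup>2 + 1 / (real k)\<^sup>2"
    proof (cases "k = 0")
      case False
      \<comment> \<open>Both factors of \<open>(k\<^sup>2 * |a k|) * (1 / k)\<close> are square summable.\<close>
      have "real k * norm (fourier_coeff u (int k)) = b k * (1 / real k)"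
        using False by (simp add: b power2_eq_square)
      also have "\<dots> \<le> 2 * b k * (1 / real k)"
        by (intro mult_right_mono) (auto simp: b_def)
      also have "\<dots> \<le> (b k)\<^sup>2 + (1 / real k)\<^sup>2"
        by (rule sum_squares_bound)
      finally show ?thesis by (simp add: power_divide)
    qed simp
  qed simp
qed

lemma summable_of_weighted:
  fixes c :: "nat \<Rightarrow> complex"
  assumes "(\<lambda>k. real k * norm (c k)) summable_on UNIV"
  shows "(\<lambda>k. norm (c k)) summable_on UNIV"
proof -
  have "(\<lambda>k. norm (c k)) summable_on ({0} \<union> {1..})"
  proof (rule summable_on_union)
    show "(\<lambda>k. norm (c k)) summable_on {1..}"
    proof (rule summable_on_comparison_test)
      show "(\<lambda>k. real k * norm (c k)) summable_on {1..}"
        using assms by (rule summable_on_subset) simp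
      show "norm (c k) \<le> real k * norm (c k)" if "k \<in> {1..}" for k
        using that mult_right_mono[of 1 "real k" "norm (c k)"] by simp
    qed simp
  qed simp
  moreover have "{0} \<union> {1..} = (UNIV :: nat set)" by auto
  ultimately show ?thesis by simp
qed

text \<open>The hypothesis \<open>u = szego u\<close> is a pointwise identity whose right side is by definition the
  Fourier series of \<open>u\<close> over non-negative frequencies. As soon as the coefficients are
  absolutely summable it therefore says that this series converges to \<open>u\<close> at every point.\<close>

lemma szego_fixed_expansion:
  assumes "u = szego u"
    and "(\<lambda>k. norm (fourier_coeff u (int k))) summable_on UNIV"
  shows "trig_expansion u (\<lambda>k. fourier_coeff u (int k)) int"
proof (rule trig_expansionI[OF assms(2)])
  fix x :: real
  let ?t = "\<lambda>k. fourier_coeff u k * cis (of_int k * x)"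
  have "(\<lambda>k. norm (?t (int k))) summable_on UNIV"
    using assms(2) by (simp add: norm_mult)
  then have "(\<lambda>k. ?t (int k)) summable_on UNIV"
    by (rule abs_summable_summable)
  then have sum: "((\<lambda>k. ?t (int k)) has_sum infsum (\<lambda>k. ?t (int k)) UNIV) UNIV"
    by (rule has_sum_infsum)
  then have "(?t has_sum infsum (\<lambda>k. ?t (int k)) UNIV) {0..}"
    by (rule iffD1[OF has_sum_reindex_bij_witness[where j = int and i = nat, OF _ _ _ _ _ refl], rotated -1]) auto
  then have "((\<lambda>k. indicator {0..} k * fourier_coeff u k * cis (of_int k * x)) has_sum
      infsum (\<lambda>k. ?t (int k)) UNIV) UNIV"
    by (rule iffD1[OF has_sum_cong_neutral, rotated -1]) (auto simp: indicator_def)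
  then have "szego u x = infsum (\<lambda>k. ?t (int k)) UNIV"
    unfolding szego_def fourier_multiplier_def by (rule infsumI)
  then show "((\<lambda>k. ?t (int k)) has_sum u x) UNIV"
    using sum assms(1) by simp
qed

section \<open>The cubic integral\<close>

text \<open>The kernel that three exponentials of frequencies \<open>k\<close>, \<open>l\<close>, \<open>- m\<close> produce in the cubic
  integral, written as a trigonometric polynomial so that it is manifestly continuous and bounded.\<close>

definition cubic_kernel :: "nat \<Rightarrow> nat \<Rightarrow> nat \<Rightarrow> real \<Rightarrow> complex" where
  "cubic_kernel k l m t =
     2 * (\<Sum>i<k. cis (of_nat i * t)) * (\<Sum>j<m. cis (- (of_nat j * t))) * (1 - cis (of_nat l * t))"

text \<open>With \<open>z = cis t\<close>, the denominator satisfies \<open>2 * (1 - cos t) = (1 - z) * (1 - cnj z)\<close>. Its two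
  factors divide \<open>1 - z ^ k\<close> and \<open>1 - cnj z ^ m\<close> as geometric sums, while the factor
  \<open>1 - z ^ l\<close> is left over.\<close>

lemma cubic_kernel_eq:
  "(1 - cis (of_nat k * t)) * ((1 - cis (of_nat l * t)) * (1 - cis (- (of_nat m * t)))) /
     complex_of_real (1 - cos t) = cubic_kernel k l m t"
proof (cases "cos t = 1")
  case True
  \<comment> \<open>On the diagonal the left side is \<open>x / 0 = 0\<close>, and the right side is \<open>0\<close> because its last
    factor is.\<close>
  then have "sin t = 0"
    using sin_cos_squared_add[of t] by simp
  with True have "cis t = 1"
    by (simp add: complex_eq_iff)
  then have "cis (of_nat l * t) = 1"
    using Complex.DeMoivre[of t l] by simp
  then show ?thesis
    by (simp add: cubic_kernel_def)
next
  case False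
  have pos: "1 - cis (of_nat n * t) = (1 - cis t) * (\<Sum>i<n. cis (of_nat i * t))" for n
    using one_diff_power_eq[of "cis t" n] by (simp add: Complex.DeMoivre)
  have neg: "1 - cis (- (of_nat n * t)) = (1 - cis (- t)) * (\<Sum>j<n. cis (- (of_nat j * t)))" for n
    using one_diff_power_eq[of "cis (- t)" n] by (simp add: Complex.DeMoivre)
  have "(1 - cis t) * (1 - cis (- t)) = 2 - (cis t + cis (- t))"
    by (simp add: algebra_simps cis_mult)
  also have "\<dots> = 2 * complex_of_real (1 - cos t)"
    by (simp add: complex_eq_iff)
  finally have dist: "(1 - cis t) * (1 - cis (- t)) = 2 * complex_of_real (1 - cos t)" .
  have regroup: "(v * S) * (X * (w * R)) = (v * w) * (S * R * X)" for v w S R X :: complex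
    by (simp only: mult_ac)
  have "(1 - cis (of_nat k * t)) * ((1 - cis (of_nat l * t)) * (1 - cis (- (of_nat m * t)))) =
      ((1 - cis t) * (1 - cis (- t))) * ((\<Sum>i<k. cis (of_nat i * t)) *
        (\<Sum>j<m. cis (- (of_nat j * t))) * (1 - cis (of_nat l * t)))"
    unfolding pos[of k] neg[of m] by (rule regroup)
  also have "\<dots> = complex_of_real (1 - cos t) * cubic_kernel k l m t"
    unfolding dist cubic_kernel_def by (simp only: mult_ac)
  also have "\<dots> / complex_of_real (1 - cos t) = cubic_kernel k l m t"
  proof (rule nonzero_mult_div_cancel_left)
    from False have "1 - cos t \<noteq> 0" by simp
    then show "complex_of_real (1 - cos t) \<noteq> 0" unfolding of_real_eq_0_iff .
  qed
  finally show ?thesis .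
qed

lemma norm_cubic_kernel_le: "norm (cubic_kernel k l m t) \<le> 4 * real k * real m"
proof -
  have "norm (\<Sum>i<k. cis (of_nat i * t)) \<le> real k"
    by (rule order_trans[OF norm_sum]) simp
  moreover have "norm (\<Sum>j<m. cis (- (of_nat j * t))) \<le> real m"
    by (rule order_trans[OF norm_sum]) simp
  moreover have "norm (1 - cis (of_nat l * t)) \<le> 2"
    by (rule order_trans[OF norm_triangle_ineq4]) simp
  ultimately have "norm (\<Sum>i<k. cis (of_nat i * t)) * norm (\<Sum>j<m. cis (- (of_nat j * t)))
      * norm (1 - cis (of_nat l * t)) \<le> real k * real m * 2"
    by (intro mult_mono) auto
  then show ?thesis
    by (simp add: cubic_kernel_def norm_mult mult_ac)
qed

lemma sum_diagonal_shift:
  "(\<Sum>i<k. \<Sum>j<m. (if i + l = j then 1 else 0 :: complex)) = of_nat (min k (m - l))"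
proof -
  have "(\<Sum>i<k. \<Sum>j<m. (if i + l = j then 1 else 0 :: complex)) = (\<Sum>i<k. if i < m - l then 1 else 0)"
    by (intro sum.cong refl) auto
  also have "\<dots> = of_nat (card {i. i < k \<and> i < m - l})"
    by (subst sum.inter_filter[symmetric]) auto
  also have "{i. i < k \<and> i < m - l} = {..<min k (m - l)}" by auto
  finally show ?thesis by simp
qed

text \<open>Multiplying out the geometric sums, the mean counts the pairs \<open>i < k\<close>, \<open>j < m\<close> with \<open>i = j\<close> and
  subtracts the number of those with \<open>i + l = j\<close>. The difference \<open>m - l\<close> is the truncated one.\<close>

lemma mean_cubic_kernel:
  "fourier_coeff (\<lambda>y. c * cubic_kernel k l m (y - x)) 0 =
     c * (2 * (of_nat (min k m) - of_nat (min k (m - l))))"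
proof -
  let ?d = "\<lambda>n::int. if n = 0 then 1 else 0 :: complex"
  let ?e = "\<lambda>n y. (2 * c * cis (- (of_int n * x))) * cis (of_int n * y)"
  have e: "fourier_coeff (?e n) 0 = 2 * c * ?d n" for n
    by (simp only: fourier_coeff_cis) auto
  have "c * cubic_kernel k l m (y - x) =
      (\<Sum>i<k. \<Sum>j<m. ?e (int i - int j) y - ?e (int (i + l) - int j) y)" for y
  proof -
    have "c * cubic_kernel k l m (y - x) =
      (\<Sum>i<k. \<Sum>j<m. 2 * c * (cis (of_nat i * (y - x)) * cis (- (of_nat j * (y - x)))
         * (1 - cis (of_nat l * (y - x)))))"
      unfolding cubic_kernel_def by (simp add: sum_product sum_distrib_left sum_distrib_right mult_ac)
    also have "\<dots> = (\<Sum>i<k. \<Sum>j<m. ?e (int i - int j) y - ?e (int (i + l) - int j) y)"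
      by (intro sum.cong refl) (simp add: algebra_simps cis_mult)
    finally show ?thesis .
  qed
  then have "fourier_coeff (\<lambda>y. c * cubic_kernel k l m (y - x)) 0 =
      fourier_coeff (\<lambda>y. \<Sum>i<k. \<Sum>j<m. ?e (int i - int j) y - ?e (int (i + l) - int j) y) 0"
    by (simp only:)
  also have "\<dots> = (\<Sum>i<k. \<Sum>j<m. 2 * c * ?d (int i - int j) - 2 * c * ?d (int (i + l) - int j))"
    by (subst fourier_coeff_sum fourier_coeff_diff e; (intro continuous_intros finite_lessThan)?)+ (rule refl)
  also have "\<dots> = (\<Sum>i<k. \<Sum>j<m. 2 * c * (if i + 0 = j then 1 else 0) - 2 * c * (if i + l = j then 1 else 0))"
    by (intro sum.cong refl) auto
  also have "\<dots> = 2 * c * ((\<Sum>i<k. \<Sum>j<m. (if i + 0 = j then 1 else 0))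
      - (\<Sum>i<k. \<Sum>j<m. (if i + l = j then 1 else 0)))"
    by (simp only: sum_distrib_left right_diff_distrib sum_subtractf)
  also have "\<dots> = 2 * c * (of_nat (min k m) - of_nat (min k (m - l)))"
    unfolding sum_diagonal_shift by simp
  finally show ?thesis by (simp add: mult_ac)
qed

lemma has_sum_increment:
  assumes "trig_expansion u a int"
  shows "((\<lambda>k. a k * cis (of_nat k * x) * (1 - cis (of_nat k * (y - x)))) has_sum u x - u y) UNIV"
proof -
  have "((\<lambda>k. a k * cis (of_int (int k) * x) + - (a k * cis (of_int (int k) * y))) has_sum u x + - u y) UNIV"
    by (intro has_sum_add has_sum_uminusI trig_expansion_has_sum[OF assms])
  moreover have "a k * cis (of_int (int k) * x) + - (a k * cis (of_int (int k) * y)) =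
      a k * cis (of_nat k * x) * (1 - cis (of_nat k * (y - x)))" for k
    by (simp add: algebra_simps cis_mult)
  ultimately show ?thesis by simp
qed

text \<open>Insert the expansion of \<open>u x - u y\<close> into the three factors of the numerator and integrate the
  resulting triple series over \<open>y\<close> term by term; each term is a multiple of a cubic kernel at
  \<open>y - x\<close>.\<close>

lemma cubic_integral_expansion:
  assumes u: "trig_expansion u a int"
    and w: "(\<lambda>k. real k * norm (a k)) summable_on UNIV"
  shows "trig_expansion (cubic_integral u)
     (\<lambda>(k, l, m). (of_nat (min k m) - of_nat (min k (m - l))) * (a k * (a l * cnj (a m))))
     (\<lambda>(k, l, m). int k + int l - int m)"
proof (rule trig_expansionI)
  have a: "(\<lambda>k. norm (a k)) summable_on UNIV"
    by (rule trig_expansion_summable[OF u])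
  have a': "(\<lambda>k. norm (cnj (a k))) summable_on UNIV"
    using a by simp
  have ka: "(\<lambda>k. norm (of_nat k * a k)) summable_on UNIV"
    using w by (simp add: norm_mult)
  have ka': "(\<lambda>k. norm (of_nat k * cnj (a k))) summable_on UNIV"
    using w by (simp add: norm_mult)
  have "(\<lambda>p. norm (case p of (k, q) \<Rightarrow> (of_nat k * a k) * (case q of (l, m) \<Rightarrow> a l * cnj (a m)))) summable_on UNIV"
    by (rule abs_summable_times[OF ka abs_summable_times[OF a a']])
  then show "(\<lambda>j. norm (case j of (k, l, m) \<Rightarrow>
      (of_nat (min k m) - of_nat (min k (m - l))) * (a k * (a l * cnj (a m))))) summable_on UNIV"
  proof (rule Infinite_Sum.abs_summable_on_comparison_test')
    fix j :: "nat \<times> nat \<times> nat"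
    obtain k l m where j: "j = (k, l, m)" by (cases j)
    have "norm (of_nat (min k m) - of_nat (min k (m - l)) :: complex) = real (min k m - min k (m - l))"
      by (subst of_nat_diff[symmetric]) (auto simp: norm_of_nat simp del: of_nat_diff)
    also have "\<dots> \<le> real k" by simp
    finally have "norm (of_nat (min k m) - of_nat (min k (m - l)) :: complex) \<le> real k" .
    then have "norm (of_nat (min k m) - of_nat (min k (m - l)) :: complex) * norm (a k * (a l * cnj (a m)))
        \<le> real k * norm (a k * (a l * cnj (a m)))"
      by (rule mult_right_mono) simp
    then show "norm (case j of (k, l, m) \<Rightarrow>
      (of_nat (min k m) - of_nat (min k (m - l))) * (a k * (a l * cnj (a m))))
      \<le> norm (case j of (k, q) \<Rightarrow> (of_nat k * a k) * (case q of (l, m) \<Rightarrow> a l * cnj (a m)))"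
      by (simp add: j norm_mult mult_ac)
  qed
  fix x :: real
  define I where "I = (\<lambda>y. complex_of_real ((cmod (u x - u y))\<^sup>2) * (u x - u y) / complex_of_real (1 - cos (x - y)))"
  define g where "g = (\<lambda>(k, l, m) y. a k * (a l * cnj (a m)) * cis ((real k + real l - real m) * x) * cubic_kernel k l m (y - x))"
  have sum: "((\<lambda>j. g j y) has_sum I y) UNIV" for y
  proof -
    let ?v = "\<lambda>k. a k * cis (of_nat k * x) * (1 - cis (of_nat k * (y - x)))"
    let ?D = "complex_of_real (1 - cos (y - x))"
    have v: "(?v has_sum u x - u y) UNIV"
      by (rule has_sum_increment[OF u])
    then have v': "((\<lambda>k. cnj (?v k)) has_sum cnj (u x - u y)) UNIV"
      by (subst has_sum_cnj_iff)
    have nv: "(\<lambda>k. norm (?v k)) summable_on UNIV"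
      by (rule iffD1[OF summable_on_iff_abs_summable_on_complex has_sum_imp_summable[OF v]])
    then have nv': "(\<lambda>k. norm (cnj (?v k))) summable_on UNIV" by (simp only: complex_mod_cnj)
    have "((\<lambda>(k, q). ?v k * (case q of (l, m) \<Rightarrow> ?v l * cnj (?v m))) has_sum
        (u x - u y) * ((u x - u y) * cnj (u x - u y))) UNIV"
      by (rule has_sum_product[OF v has_sum_product[OF v v' abs_summable_times[OF nv nv']]
            abs_summable_times[OF nv abs_summable_times[OF nv nv']]])
    then have product: "((\<lambda>p. (case p of (k, q) \<Rightarrow> ?v k * (case q of (l, m) \<Rightarrow> ?v l * cnj (?v m))) * (1 / ?D)) has_sum
        (u x - u y) * ((u x - u y) * cnj (u x - u y)) * (1 / ?D)) UNIV"
      by (rule has_sum_cmult_left)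
    have limit: "(u x - u y) * ((u x - u y) * cnj (u x - u y)) * (1 / ?D) = I y"
      unfolding I_def complex_norm_square
      by (simp add: cos_diff divide_inverse mult_ac)
    have terms: "(\<lambda>p. (case p of (k, q) \<Rightarrow> ?v k * (case q of (l, m) \<Rightarrow> ?v l * cnj (?v m))) * (1 / ?D))
        = (\<lambda>j. g j y)"
    proof
      fix j :: "nat \<times> nat \<times> nat"
      obtain k l m where j: "j = (k, l, m)" by (cases j)
      have phase: "cis ((real k + real l - real m) * x) =
          cis (real k * x) * (cis (real l * x) * cis (- (real m * x)))"
        by (simp add: cis_mult algebra_simps)
      have "?v k * (?v l * cnj (?v m)) * (1 / ?D) = g (k, l, m) y"
        unfolding g_def prod.case phase cubic_kernel_eq[symmetric] divide_inverse
          complex_cnj_mult complex_cnj_diff complex_cnj_one cis_cnj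
        by (simp only: mult_ac mult_1_left)
      then show "(case j of (k, q) \<Rightarrow> ?v k * (case q of (l, m) \<Rightarrow> ?v l * cnj (?v m))) * (1 / ?D)
          = g j y"
        unfolding j prod.case .
    qed
    show ?thesis
      using product unfolding limit terms .
  qed
  \<comment> \<open>The majorant is independent of \<open>y\<close> and costs one power each of \<open>k\<close> and \<open>m\<close>, carried by
    different coefficients.\<close>
  let ?M = "\<lambda>j. 4 * norm (case j of (k, q) \<Rightarrow> (of_nat k * a k) * (case q of (l, m) \<Rightarrow> a l * (of_nat m * cnj (a m))))"
  have "((\<lambda>j. fourier_coeff (g j) 0) has_sum fourier_coeff I 0) UNIV"
  proof (rule fourier_coeff_has_sum[where M = ?M])
    show "continuous_on {0..2 * pi} (g j)" for j
      unfolding g_def cubic_kernel_def by (cases j) (auto intro!: continuous_intros)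
    show "?M summable_on UNIV"
      by (rule summable_on_cmult_right[OF abs_summable_times[OF ka abs_summable_times[OF a ka']]])
    show "norm (g j y) \<le> ?M j" for j y
    proof -
      obtain k l m where j: "j = (k, l, m)" by (cases j)
      have "norm (a k) * norm (a l) * norm (a m) * norm (cubic_kernel k l m (y - x))
          \<le> norm (a k) * norm (a l) * norm (a m) * (4 * real k * real m)"
        by (intro mult_left_mono norm_cubic_kernel_le) simp
      then show ?thesis by (simp add: j g_def norm_mult mult_ac)
    qed
  qed (rule sum)
  then have "((\<lambda>j. 1 / 2 * fourier_coeff (g j) 0) has_sum 1 / 2 * fourier_coeff I 0) UNIV"
    by (rule has_sum_cmult_right)
  \<comment> \<open>\<open>1 / (4 * pi)\<close> is half the normalisation \<open>1 / (2 * pi)\<close> of the mean value.\<close>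
  moreover have "1 / 2 * fourier_coeff I 0 = cubic_integral u x"
    by (simp add: fourier_coeff_def cubic_integral_def I_def)
  moreover have "(\<lambda>j. 1 / 2 * fourier_coeff (g j) 0) = (\<lambda>j. (case j of (k, l, m) \<Rightarrow>
      (of_nat (min k m) - of_nat (min k (m - l))) * (a k * (a l * cnj (a m)))) *
      cis (of_int (case j of (k, l, m) \<Rightarrow> int k + int l - int m) * x))"
    unfolding g_def by (auto simp: mean_cubic_kernel)
  ultimately show "((\<lambda>j. (case j of (k, l, m) \<Rightarrow>
      (of_nat (min k m) - of_nat (min k (m - l))) * (a k * (a l * cnj (a m)))) *
      cis (of_int (case j of (k, l, m) \<Rightarrow> int k + int l - int m) * x)) has_sum cubic_integral u x) UNIV"
    by simp
qed

section \<open>The commutator form and the comparison of symbols\<close>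

text \<open>On exponentials of frequencies \<open>k\<close>, \<open>l\<close>, \<open>- m\<close>, the operator \<open>\<Lambda>\<close> contributes \<open>2 * pi * k\<close> when it
  hits \<open>u\<close> and \<open>2 * pi * |l - m|\<close> when it hits \<open>|u|\<^sup>2\<close>.\<close>

lemma nonlinear_term_expansion:
  assumes u: "trig_expansion u a int"
    and w: "(\<lambda>k. real k * norm (a k)) summable_on UNIV"
  shows "trig_expansion
     (\<lambda>y. complex_of_real ((cmod (u y))\<^sup>2) * Lambda u y
          - u y * Lambda (\<lambda>z. complex_of_real ((cmod (u z))\<^sup>2)) y)
     (\<lambda>(k, l, m). complex_of_real (2 * pi) * of_int (int k - \<bar>int l - int m\<bar>) * (a k * (a l * cnj (a m))))
     (\<lambda>(k, l, m). int k + int l - int m)"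
proof -
  have a: "(\<lambda>k. norm (a k)) summable_on UNIV"
    by (rule trig_expansion_summable[OF u])
  have ka: "(\<lambda>k. norm (of_nat k * a k)) summable_on UNIV"
    using w by (simp add: norm_mult)
  let ?\<sigma> = "\<lambda>k::int. complex_of_real (2 * pi * \<bar>of_int k\<bar>)"
  let ?sq = "\<lambda>(l, m). a l * cnj (a m)" and ?n = "\<lambda>(l, m). int l + - int m"
  have Lu: "trig_expansion (Lambda u) (\<lambda>k. ?\<sigma> (int k) * a k) int"
    unfolding Lambda_def
  proof (rule trig_expansion_multiplier[OF u])
    have "(\<lambda>k. (2 * pi) * norm (of_nat k * a k)) summable_on UNIV"
      by (rule summable_on_cmult_right[OF ka])
    then show "(\<lambda>k. norm (?\<sigma> (int k) * a k)) summable_on UNIV"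
      by (simp add: norm_mult mult_ac)
  qed
  have sq: "trig_expansion (\<lambda>z. complex_of_real ((cmod (u z))\<^sup>2)) ?sq ?n"
    unfolding complex_norm_square by (rule trig_expansion_mult[OF u trig_expansion_cnj[OF u]])
  have Lsq: "trig_expansion (Lambda (\<lambda>z. complex_of_real ((cmod (u z))\<^sup>2))) (\<lambda>q. ?\<sigma> (?n q) * ?sq q) ?n"
    unfolding Lambda_def
  proof (rule trig_expansion_multiplier[OF sq])
    have "(\<lambda>p. 2 * pi * (norm (case p of (l, m) \<Rightarrow> (of_nat l * a l) * a m)
        + norm (case p of (l, m) \<Rightarrow> a l * (of_nat m * a m)))) summable_on UNIV"
      by (intro summable_on_cmult_right summable_on_add abs_summable_times ka a)
    then show "(\<lambda>q. norm (?\<sigma> (?n q) * ?sq q)) summable_on UNIV"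
    proof (rule Infinite_Sum.abs_summable_on_comparison_test')
      fix q :: "nat \<times> nat"
      obtain l m where q: "q = (l, m)" by (cases q)
      have "\<bar>real l - real m\<bar> * (norm (a l) * norm (a m)) \<le> (real l + real m) * (norm (a l) * norm (a m))"
        by (intro mult_right_mono) auto
      then have "2 * pi * (\<bar>real l - real m\<bar> * (norm (a l) * norm (a m)))
          \<le> 2 * pi * ((real l + real m) * (norm (a l) * norm (a m)))"
        by (intro mult_left_mono) auto
      then show "norm (?\<sigma> (?n q) * ?sq q) \<le> 2 * pi * (norm (case q of (l, m) \<Rightarrow> (of_nat l * a l) * a m)
        + norm (case q of (l, m) \<Rightarrow> a l * (of_nat m * a m)))"
        by (simp add: q norm_mult algebra_simps)
    qed
  qed
  have 1: "trig_expansion (\<lambda>y. Lambda u y * complex_of_real ((cmod (u y))\<^sup>2))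
     (\<lambda>(k, q). ?\<sigma> (int k) * a k * ?sq q) (\<lambda>(k, q). int k + ?n q)"
    by (rule trig_expansion_mult[OF Lu sq])
  have 2: "trig_expansion (\<lambda>y. u y * Lambda (\<lambda>z. complex_of_real ((cmod (u z))\<^sup>2)) y)
     (\<lambda>(k, q). a k * (?\<sigma> (?n q) * ?sq q)) (\<lambda>(k, q). int k + ?n q)"
    by (rule trig_expansion_mult[OF u Lsq])
  have c: "(\<lambda>j. (case j of (k, q) \<Rightarrow> ?\<sigma> (int k) * a k * ?sq q) - (case j of (k, q) \<Rightarrow> a k * (?\<sigma> (?n q) * ?sq q)))
      = (\<lambda>(k, l, m). complex_of_real (2 * pi) * of_int (int k - \<bar>int l - int m\<bar>) * (a k * (a l * cnj (a m))))"
  proof -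
    have \<sigma>: "?\<sigma> n = complex_of_real (2 * pi) * of_int \<bar>n\<bar>" for n
      by (simp flip: of_int_abs)
    show ?thesis
      unfolding \<sigma> by (auto simp: fun_eq_iff algebra_simps)
  qed
  have n: "(\<lambda>(k, q). int k + ?n q) = (\<lambda>(k, l, m). int k + int l - int m)"
    by (auto simp: fun_eq_iff)
  show ?thesis
    using trig_expansion_diff[OF 1 2] unfolding c n by (simp only: mult.commute)
qed

text \<open>For a non-negative output frequency \<open>k + l - m\<close>, the symbol of the cubic integral is the average
  of the symbol \<open>k - |l - m|\<close> over the exchange of \<open>k\<close> and \<open>l\<close>. This fails for negative
  output frequencies, which is why the identity needs the projection.\<close>

lemma symbol_symmetrization:
  fixes k l m :: nat
  assumes "m \<le> k + l"
  shows "2 * (int (min k m) - int (min k (m - l))) =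
    (int k - \<bar>int l - int m\<bar>) + (int l - \<bar>int k - int m\<bar>)"
  using assms by (auto simp: min_def)

theorem lemmaB2:
  fixes u :: "real \<Rightarrow> complex" and a :: "int \<Rightarrow> complex" and x :: real
  assumes "torus_fun u"
    and "C2_fun u"
    and "u = szego u"
    and "a = fourier_coeff u"
  shows "szego (cubic_integral u) x =
           1 / complex_of_real (2 * pi) *
           szego (\<lambda>y. complex_of_real ((cmod (u y))\<^sup>2) * Lambda u y
                     - u y * Lambda (\<lambda>z. complex_of_real ((cmod (u z))\<^sup>2)) y) x
         \<and> ((\<lambda>(k, l, m, p). cis (of_int p * x) * of_int (k - \<bar>k - p\<bar>) * a k * a l * cnj (a m))
           has_sum
           (1 / complex_of_real (2 * pi) *
            szego (\<lambda>y. complex_of_real ((cmod (u y))\<^sup>2) * Lambda u y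
                      - u y * Lambda (\<lambda>z. complex_of_real ((cmod (u z))\<^sup>2)) y) x))
         {(k, l, m, p). p = k + l - m \<and> k \<ge> 0 \<and> l \<ge> 0 \<and> m \<ge> 0 \<and> p \<ge> 0}"
proof -
  define b where "b = (\<lambda>k. a (int k))"
  have w: "(\<lambda>k. real k * norm (b k)) summable_on UNIV"
    using C2_fun_summable_weighted[OF assms(1,2)] by (simp add: b_def assms(4))
  then have "(\<lambda>k. norm (b k)) summable_on UNIV"
    by (rule summable_of_weighted)
  then have u: "trig_expansion u b int"
    using szego_fixed_expansion[OF assms(3)] by (simp add: b_def assms(4))
  define N where "N = 1 / complex_of_real (2 * pi) *
           szego (\<lambda>y. complex_of_real ((cmod (u y))\<^sup>2) * Lambda u y
                     - u y * Lambda (\<lambda>z. complex_of_real ((cmod (u z))\<^sup>2)) y) x"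
  define T where "T = (\<lambda>(k, l, m). indicator {0..} (int k + int l - int m) * of_int (int k - \<bar>int l - int m\<bar>) *
      (b k * (b l * cnj (b m))) * cis (of_int (int k + int l - int m) * x))"
  have T: "(T has_sum N) UNIV"
    using has_sum_cmult_right[OF trig_expansion_has_sum[OF szego_expansion[OF nonlinear_term_expansion[OF u w]], of x],
        of "1 / complex_of_real (2 * pi)"]
    unfolding N_def[symmetric]
    by (rule iffD1[OF has_sum_cong, rotated]) (auto simp: T_def)
  \<comment> \<open>The product \<open>b k * b l\<close> and the frequency are symmetric in \<open>k\<close> and \<open>l\<close>, so the symbol may be
    averaged over the exchange of the two indices.\<close>
  have swap: "((\<lambda>(k, l, m). T (l, k, m)) has_sum N) UNIV"
    by (rule iffD1[OF has_sum_reindex_bij_witness[where j = "\<lambda>(k, l, m). (l, k, m)" and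
        i = "\<lambda>(k, l, m). (l, k, m)", OF _ _ _ _ _ refl] T]) auto
  have "((\<lambda>j. 1 / 2 * (T j + (case j of (k, l, m) \<Rightarrow> T (l, k, m)))) has_sum 1 / 2 * (N + N)) UNIV"
    by (intro has_sum_cmult_right has_sum_add T swap)
  moreover have "((\<lambda>j. 1 / 2 * (T j + (case j of (k, l, m) \<Rightarrow> T (l, k, m)))) has_sum szego (cubic_integral u) x) UNIV"
  proof (rule iffD1[OF has_sum_cong trig_expansion_has_sum[OF szego_expansion[OF cubic_integral_expansion[OF u w]], of x]])
    fix j :: "nat \<times> nat \<times> nat"
    obtain k l m where j: "j = (k, l, m)" by (cases j)
    show "indicator {0..} (case j of (k, l, m) \<Rightarrow> int k + int l - int m) *
        (case j of (k, l, m) \<Rightarrow> (of_nat (min k m) - of_nat (min k (m - l))) * (b k * (b l * cnj (b m)))) *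
        cis (of_int (case j of (k, l, m) \<Rightarrow> int k + int l - int m) * x) =
        1 / 2 * (T j + (case j of (k, l, m) \<Rightarrow> T (l, k, m)))"
    proof (cases "m \<le> k + l")
      case False
      then show ?thesis by (simp add: j T_def)
    next
      case True
      have "of_nat (min k m) - of_nat (min k (m - l)) =
          1 / 2 * (of_int (2 * (int (min k m) - int (min k (m - l)))) :: complex)"
        by simp
      then have sym: "of_nat (min k m) - of_nat (min k (m - l)) =
          1 / 2 * (of_int (int k - \<bar>int l - int m\<bar>) + of_int (int l - \<bar>int k - int m\<bar>) :: complex)"
        unfolding symbol_symmetrization[OF True] of_int_add .
      have "int l + int k - int m = int k + int l - int m" by simp
      then show ?thesis
        using True unfolding j T_def prod.case sym by (simp add: algebra_simps)
    qed
  qed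
  ultimately have 1: "szego (cubic_integral u) x = N"
    using has_sum_unique by fastforce
  let ?S = "{(k, l, m, p). p = k + l - m \<and> k \<ge> 0 \<and> l \<ge> 0 \<and> m \<ge> 0 \<and> p \<ge> (0::int)}"
  let ?P = "{(k, l, m). m \<le> k + (l::nat)}"
  \<comment> \<open>Passing to the index set of the theorem: there \<open>k - p = m - l\<close>.\<close>
  have "(T has_sum N) ?P"
    by (rule iffD1[OF has_sum_cong_neutral T]) (auto simp: T_def)
  then have 2: "((\<lambda>(k, l, m, p). cis (of_int p * x) * of_int (k - \<bar>k - p\<bar>) * a k * a l * cnj (a m)) has_sum N) ?S"
    by (rule iffD1[OF has_sum_reindex_bij_witness[where j = "\<lambda>(k, l, m). (int k, int l, int m, int k + int l - int m)" and
          i = "\<lambda>(k, l, m, p). (nat k, nat l, nat m)", OF _ _ _ _ _ refl], rotated -1])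
       (auto simp: T_def b_def abs_minus_commute)
  show ?thesis
    using 1 2 unfolding N_def by blast
qed

end
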